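(* Let $G$ be a connected graph. For any proper subset $S \subsetneq V(L(G))$ with $|S| \leq \left\lceil \frac{\min\{\delta(G),\kappa(L(G))\}}{2} \right\rceil$, the graph $L(G)-S$ has $\left\lfloor \frac{\min\{\delta(G),\kappa(L(G))\}}{2} \right\rfloor$ completely independent spanning trees. Moreover, if $G$ is not super edge-connected, then for any $S \subsetneq V(L(G))$ with $|S| \leq \left\lceil \frac{\kappa(L(G))}{2} \right\rceil$, the graph $L(G)-S$ has $\left\lfloor \frac{\kappa(L(G))}{2} \right\rfloor$ completely independent spanning trees.
   Context: All graphs are finite, simple and undirected. $L(G)$ is the line graph of $G$ (vertex set $E(G)$, two vertices adjacent iff the corresponding edges share an endpoint). $\delta(G)$ is the minimum degree of $G$ and $\kappa(H)$ the (vertex) connectivity of $H$. $L(G)-S$ is obtained by deleting the vertices in $S$. An edge-cut of a connected graph is a set of edges whose removal disconnects it; a connected graph is super edge-connected if every minimum edge-cut isolates a vertex. Spanning trees $T_1,\dots,T_k$ of a graph $H$ are completely independent if for any two distinct vertices $u,v$ of $H$, the $u$–$v$ paths in $T_1,\dots,T_k$ are pairwise edge-disjoint and pairwise share no vertex other than $u$ and $v$ (having $0$ such trees is vacuous). *)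

theory Defs
  imports Complex_Main
begin

record 'a ugraph =
  vertices :: "'a set"
  edges :: "'a set set"

definition simple_graph :: "'a ugraph \<Rightarrow> bool" where
  "simple_graph G \<longleftrightarrow>
     finite (vertices G) \<and> (\<forall>e\<in>edges G. e \<subseteq> vertices G \<and> card e = 2)"

definition degree :: "'a ugraph \<Rightarrow> 'a \<Rightarrow> nat" where
  "degree G v = card {e \<in> edges G. v \<in> e}"

definition min_degree :: "'a ugraph \<Rightarrow> nat" where
  "min_degree G = Min (degree G ` vertices G)"

definition path_edges :: "'a list \<Rightarrow> 'a set set" where
  "path_edges p = {{p ! i, p ! Suc i} | i. Suc i < length p}"

text \<open>A path is given by its list of (pairwise distinct) vertices, in order.\<close>

definition is_path :: "'a ugraph \<Rightarrow> 'a \<Rightarrow> 'a list \<Rightarrow> 'a \<Rightarrow> bool" where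
  "is_path G u p v \<longleftrightarrow>
     p \<noteq> [] \<and> hd p = u \<and> last p = v \<and> distinct p \<and>
     set p \<subseteq> vertices G \<and> path_edges p \<subseteq> edges G"

text \<open>The null graph is not connected.\<close>

definition connected_graph :: "'a ugraph \<Rightarrow> bool" where
  "connected_graph G \<longleftrightarrow>
     vertices G \<noteq> {} \<and> (\<forall>u\<in>vertices G. \<forall>v\<in>vertices G. \<exists>p. is_path G u p v)"

definition is_cycle :: "'a ugraph \<Rightarrow> 'a list \<Rightarrow> bool" where
  "is_cycle G c \<longleftrightarrow>
     3 \<le> length c \<and> distinct c \<and> set c \<subseteq> vertices G \<and>
     path_edges c \<subseteq> edges G \<and> {last c, hd c} \<in> edges G"

definition is_tree :: "'a ugraph \<Rightarrow> bool" where
  "is_tree T \<longleftrightarrow> simple_graph T \<and> connected_graph T \<and> (\<nexists>c. is_cycle T c)"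

definition is_spanning_tree :: "'a ugraph \<Rightarrow> 'a ugraph \<Rightarrow> bool" where
  "is_spanning_tree T H \<longleftrightarrow> is_tree T \<and> vertices T = vertices H \<and> edges T \<subseteq> edges H"

definition delete_vertices :: "'a ugraph \<Rightarrow> 'a set \<Rightarrow> 'a ugraph" where
  "delete_vertices G S =
     \<lparr>vertices = vertices G - S, edges = {e \<in> edges G. e \<inter> S = {}}\<rparr>"

definition delete_edges :: "'a ugraph \<Rightarrow> 'a set set \<Rightarrow> 'a ugraph" where
  "delete_edges G F = \<lparr>vertices = vertices G, edges = edges G - F\<rparr>"

definition line_graph :: "'a ugraph \<Rightarrow> 'a set ugraph" where
  "line_graph G =
     \<lparr>vertices = edges G,
      edges = {{e, f} | e f. e \<in> edges G \<and> f \<in> edges G \<and> e \<noteq> f \<and> e \<inter> f \<noteq> {}}\<rparr>"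

text \<open>
  The least number of vertices whose deletion leaves a disconnected graph or at most one
  vertex; in particular a complete graph on \<open>n \<ge> 1\<close> vertices has connectivity \<open>n - 1\<close>.
\<close>

definition vertex_connectivity :: "'a ugraph \<Rightarrow> nat" where
  "vertex_connectivity G =
     (LEAST k. \<exists>S\<subseteq>vertices G. card S = k \<and>
        (\<not> connected_graph (delete_vertices G S) \<or> card (vertices G - S) \<le> 1))"

definition is_edge_cut :: "'a ugraph \<Rightarrow> 'a set set \<Rightarrow> bool" where
  "is_edge_cut G F \<longleftrightarrow> F \<subseteq> edges G \<and> \<not> connected_graph (delete_edges G F)"

definition is_min_edge_cut :: "'a ugraph \<Rightarrow> 'a set set \<Rightarrow> bool" where
  "is_min_edge_cut G F \<longleftrightarrow>
     is_edge_cut G F \<and> (\<forall>F'. is_edge_cut G F' \<longrightarrow> card F \<le> card F')"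

definition super_edge_connected :: "'a ugraph \<Rightarrow> bool" where
  "super_edge_connected G \<longleftrightarrow>
     connected_graph G \<and>
     (\<forall>F. is_min_edge_cut G F \<longrightarrow> (\<exists>v\<in>vertices G. degree (delete_edges G F) v = 0))"

text \<open>
  The trees are \<open>T 0, \<dots>, T (k - 1)\<close>. Paths in a tree are unique, so quantifying over
  all \<open>u\<close>-\<open>v\<close> paths of \<open>T i\<close> refers to the \<open>u\<close>-\<open>v\<close> path of \<open>T i\<close>.
\<close>

definition completely_independent_spanning_trees ::
    "'a ugraph \<Rightarrow> nat \<Rightarrow> (nat \<Rightarrow> 'a ugraph) \<Rightarrow> bool" where
  "completely_independent_spanning_trees H k T \<longleftrightarrow>
     (\<forall>i<k. is_spanning_tree (T i) H) \<and>
     (\<forall>u\<in>vertices H. \<forall>v\<in>vertices H. u \<noteq> v \<longrightarrow>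
        (\<forall>i<k. \<forall>j<k. i \<noteq> j \<longrightarrow>
           (\<forall>p q. is_path (T i) u p v \<and> is_path (T j) u q v \<longrightarrow>
              path_edges p \<inter> path_edges q = {} \<and> set p \<inter> set q = {u, v})))"

definition has_cists :: "'a ugraph \<Rightarrow> nat \<Rightarrow> bool" where
  "has_cists H k \<longleftrightarrow> (\<exists>T. completely_independent_spanning_trees H k T)"

end

theory Submission
  imports Defs "HOL-Library.Disjoint_Sets"
begin

text \<open>
  Let \<open>m\<close> be the minimum of \<open>\<delta>(G)\<close> and \<open>\<kappa>(L(G))\<close>. A cut of \<open>G\<close> with an edge on both sides
  separates \<open>L(G)\<close>, and any other cut contains all edges at some vertex, so every cut of \<open>G\<close> has at
  least \<open>m\<close> edges. By the Nash-Williams--Tutte tree packing theorem, deleting \<open>\<lceil>m/2\<rceil>\<close> edges leaves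
  \<open>\<lfloor>m/2\<rfloor>\<close> edge-disjoint spanning trees, which we root at a common vertex. The edges of the \<open>i\<close>-th
  tree form the inner part of the \<open>i\<close>-th independent tree of the line graph, and every other edge is
  attached to that part as a leaf; the attachments can be chosen so that no two edges choose each
  other. If \<open>G\<close> is not super edge-connected, a minimum edge-cut without isolated vertices separates
  \<open>L(G)\<close>, whence \<open>\<kappa>(L(G)) \<le> \<delta>(G)\<close>.
\<close>

section \<open>Connectivity and forests\<close>

text \<open>Reachability refers to a bare edge set without a vertex set, because the exchange
  arguments only alter edge sets. Every element is reachable from itself, so isolated vertices form
  singleton classes.\<close>

definition conn :: "'a set set \<Rightarrow> ('a \<times> 'a) set" where
  "conn X = {(a, b). {a, b} \<in> X}\<^sup>*"

lemma conn_refl [simp]: "(a, a) \<in> conn X"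
  by (simp add: conn_def)

lemma conn_edge: "{a, b} \<in> X \<Longrightarrow> (a, b) \<in> conn X"
  by (simp add: conn_def r_into_rtrancl)

lemma conn_trans: "(a, b) \<in> conn X \<Longrightarrow> (b, c) \<in> conn X \<Longrightarrow> (a, c) \<in> conn X"
  unfolding conn_def by (rule rtrancl_trans)

lemma conn_sym: "(a, b) \<in> conn X \<Longrightarrow> (b, a) \<in> conn X"
  unfolding conn_def by (rule symD[OF sym_rtrancl]) (simp_all add: sym_def insert_commute)

lemma conn_induct [consumes 1, case_names base step]:
  assumes "(a, b) \<in> conn X" "P a"
    and "\<And>y z. (a, y) \<in> conn X \<Longrightarrow> {y, z} \<in> X \<Longrightarrow> P y \<Longrightarrow> P z"
  shows "P b"
  using assms unfolding conn_def by (induction rule: rtrancl_induct) auto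

lemma conn_subset:
  assumes "\<And>a b. {a, b} \<in> X \<Longrightarrow> (a, b) \<in> conn Y"
  shows "conn X \<subseteq> conn Y"
  unfolding conn_def by (rule rtrancl_subset_rtrancl) (use assms in \<open>auto simp: conn_def\<close>)

lemma conn_mono: "X \<subseteq> Y \<Longrightarrow> conn X \<subseteq> conn Y"
  by (intro conn_subset) (auto intro: conn_edge)

lemma conn_closed:
  assumes "(a, b) \<in> conn X" "\<And>e. e \<in> X \<Longrightarrow> e \<subseteq> V" "a \<in> V"
  shows "b \<in> V"
  using assms by (induction rule: conn_induct) auto

text \<open>Only the net effect of crossing the new edge matters: crossing it back cancels the first
  crossing, so the three cases persist when the walk grows by one step.\<close>

lemma conn_insert_cases:
  assumes "(a, b) \<in> conn (insert {v, w} X)"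
  shows "(a, b) \<in> conn X \<or> (a, v) \<in> conn X \<and> (w, b) \<in> conn X
    \<or> (a, w) \<in> conn X \<and> (v, b) \<in> conn X"
  using assms
proof (induction rule: conn_induct)
  case base
  then show ?case by simp
next
  case (step y z)
  show ?case
  proof (cases "{y, z} \<in> X")
    case True
    then have "(y, z) \<in> conn X" by (rule conn_edge)
    then show ?thesis using step.IH by (meson conn_trans)
  next
    case False
    then have "{y, z} = {v, w}" using step.hyps by auto
    then show ?thesis using step.IH by (auto simp: doubleton_eq_iff)
  qed
qed

text \<open>Acyclicity in the form "every edge is a bridge", which keeps all forest arguments inside
  \<open>conn\<close>. Singleton edges are thereby excluded as well.\<close>

definition forest :: "'a set set \<Rightarrow> bool" where
  "forest F \<longleftrightarrow> (\<forall>a b. {a, b} \<in> F \<longrightarrow> (a, b) \<notin> conn (F - {{a, b}}))"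

lemma forest_subset: "forest F \<Longrightarrow> F' \<subseteq> F \<Longrightarrow> forest F'"
  unfolding forest_def
proof (intro allI impI)
  fix a b
  assume "\<forall>a b. {a, b} \<in> F \<longrightarrow> (a, b) \<notin> conn (F - {{a, b}})" "F' \<subseteq> F" "{a, b} \<in> F'"
  moreover from this have "conn (F' - {{a, b}}) \<subseteq> conn (F - {{a, b}})"
    by (intro conn_mono) auto
  ultimately show "(a, b) \<notin> conn (F' - {{a, b}})" by blast
qed

text \<open>If an old edge \<open>{a, b}\<close> ceased to be a bridge, the detour between its ends
  would have to use \<open>{v, w}\<close>; together with \<open>{a, b}\<close> the rest of the
  detour would join \<open>v\<close> to \<open>w\<close> inside \<open>F\<close>.\<close>

lemma forest_insert:
  assumes F: "forest F" and vw: "(v, w) \<notin> conn F"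
  shows "forest (insert {v, w} F)"
  unfolding forest_def
proof (intro allI impI notI)
  fix a b
  assume ab: "{a, b} \<in> insert {v, w} F"
    and c: "(a, b) \<in> conn (insert {v, w} F - {{a, b}})"
  have vwF: "{v, w} \<notin> F" using vw by (metis conn_edge)
  show False
  proof (cases "{a, b} = {v, w}")
    case True
    then have "(a, b) \<in> conn F" using c vwF by simp
    then show False using vw True conn_sym by (metis doubleton_eq_iff)
  next
    case False
    then have abF: "{a, b} \<in> F" using ab by simp
    let ?F = "F - {{a, b}}"
    have sub: "conn ?F \<subseteq> conn F" by (rule conn_mono) auto
    have "(a, b) \<in> conn (insert {v, w} ?F)"
      using c False by (metis insert_Diff_if singletonD)
    moreover have "(a, b) \<notin> conn ?F" using F abF by (auto simp: forest_def)
    ultimately have c': "(a, v) \<in> conn ?F \<and> (w, b) \<in> conn ?F \<or> (a, w) \<in> conn ?F \<and> (v, b) \<in> conn ?F"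
      by (meson conn_insert_cases)
    from c' have "(a, v) \<in> conn F \<and> (w, b) \<in> conn F \<or> (a, w) \<in> conn F \<and> (v, b) \<in> conn F"
      using sub by blast
    then show False using vw conn_edge[OF abF] by (meson conn_sym conn_trans)
  qed
qed

text \<open>An inclusion-minimal connecting set stands in for the edge set of a path from
  \<open>v\<close> to \<open>w\<close>.\<close>

lemma minimal_conn_subset:
  assumes "finite F" "(v, w) \<in> conn F"
  obtains P where "P \<subseteq> F" "(v, w) \<in> conn P" "\<And>f. f \<in> P \<Longrightarrow> (v, w) \<notin> conn (P - {f})"
proof -
  let ?S = "{P. P \<subseteq> F \<and> (v, w) \<in> conn P}"
  have "finite ?S" "?S \<noteq> {}" using assms by auto
  from finite_has_minimal[OF this] obtain P
    where P: "P \<in> ?S" "\<forall>Q\<in>?S. Q \<subseteq> P \<longrightarrow> P = Q" by (rule bexE)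
  show thesis
  proof (rule that[of P])
    show "P \<subseteq> F" "(v, w) \<in> conn P" using P(1) by auto
    fix f assume f: "f \<in> P"
    show "(v, w) \<notin> conn (P - {f})"
    proof
      assume "(v, w) \<in> conn (P - {f})"
      then have "P - {f} \<in> ?S" using P(1) by auto
      then have "P = P - {f}" using P(2) by (metis Diff_subset)
      then show False using f by auto
    qed
  qed
qed

text \<open>By minimality, \<open>P - {f}\<close> joins \<open>v\<close> and \<open>w\<close> to
  different ends of \<open>f\<close>. A connection of \<open>v\<close> and \<open>w\<close> avoiding
  \<open>f\<close> would then join the ends of \<open>f\<close>, contradicting that \<open>f\<close>
  is a bridge.\<close>

lemma forest_unique_connection:
  assumes F: "forest F" and P: "P \<subseteq> F" and min: "\<And>g. g \<in> P \<Longrightarrow> (v, w) \<notin> conn (P - {g})"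
    and vwP: "(v, w) \<in> conn P" and f: "f \<in> P" "card f = 2"
  shows "(v, w) \<notin> conn (F - {f})"
proof
  assume c: "(v, w) \<in> conn (F - {f})"
  obtain a b where fab: "f = {a, b}" using f(2) by (auto simp: card_2_iff)
  have sub: "conn (P - {f}) \<subseteq> conn (F - {f})" using P by (intro conn_mono) auto
  have "insert {a, b} (P - {f}) = P" using f(1) fab by auto
  then have "(v, w) \<in> conn (insert {a, b} (P - {f}))" using vwP by simp
  then have "(v, a) \<in> conn (P - {f}) \<and> (b, w) \<in> conn (P - {f})
      \<or> (v, b) \<in> conn (P - {f}) \<and> (a, w) \<in> conn (P - {f})"
    using min[OF f(1)] by (meson conn_insert_cases)
  then have "(v, a) \<in> conn (F - {f}) \<and> (b, w) \<in> conn (F - {f})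
      \<or> (v, b) \<in> conn (F - {f}) \<and> (a, w) \<in> conn (F - {f})"
    using sub by blast
  then have "(a, b) \<in> conn (F - {f})" using c by (meson conn_sym conn_trans)
  then show False using F P f(1) fab by (auto simp: forest_def)
qed

section \<open>Components and the edge count of a forest\<close>

definition comps :: "'a set \<Rightarrow> 'a set set \<Rightarrow> 'a set set" where
  "comps V X = (\<lambda>v. conn X `` {v}) ` V"

lemma comp_eq_iff: "conn X `` {a} = conn X `` {b} \<longleftrightarrow> (a, b) \<in> conn X"
proof -
  have "equiv UNIV (conn X)"
  proof (intro equivI)
    show "sym (conn X)" by (rule symI) (rule conn_sym)
    show "trans (conn X)" by (rule transI) (rule conn_trans)
  qed (auto simp: refl_on_def)
  then show ?thesis by (simp add: eq_equiv_class_iff)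
qed

lemma comps_partition:
  assumes "\<And>e. e \<in> X \<Longrightarrow> e \<subseteq> V"
  shows "partition_on V (comps V X)"
proof (rule partition_onI)
  have "conn X `` {a} \<subseteq> V" if "a \<in> V" for a
    using conn_closed[OF _ assms that] by blast
  moreover have self: "a \<in> conn X `` {a}" for a by simp
  ultimately show "\<Union> (comps V X) = V"
    unfolding comps_def by (intro equalityI UN_least) (auto simp only: UN_iff intro: bexI)
  show "{} \<notin> comps V X"
  proof
    assume "{} \<in> comps V X"
    then obtain a where "{} = conn X `` {a}" unfolding comps_def by (rule imageE)
    then show False using self[of a] by (simp only: empty_iff)
  qed
  show "disjnt p q" if p: "p \<in> comps V X" and q: "q \<in> comps V X" and ne: "p \<noteq> q" for p q
  proof -
    obtain a where a: "p = conn X `` {a}" using p unfolding comps_def by (rule imageE)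
    obtain b where b: "q = conn X `` {b}" using q unfolding comps_def by (rule imageE)
    have False if "(a, z) \<in> conn X" "(b, z) \<in> conn X" for z
      using that ne unfolding a b by (metis comp_eq_iff)
    then show ?thesis unfolding a b disjnt_iff by (metis Image_singleton_iff)
  qed
qed

lemma comp_insert:
  assumes "(v, w) \<notin> conn F"
  shows "conn (insert {v, w} F) `` {x} =
    (if (x, v) \<in> conn F \<or> (x, w) \<in> conn F then conn F `` {v} \<union> conn F `` {w} else conn F `` {x})"
proof -
  let ?G = "insert {v, w} F"
  have sub: "conn F \<subseteq> conn ?G" by (rule conn_mono) auto
  have vw: "(v, w) \<in> conn ?G" "(w, v) \<in> conn ?G" by (rule conn_edge, simp add: insert_commute)+
  have iff: "(x, y) \<in> conn ?G \<longleftrightarrow>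
     (if (x, v) \<in> conn F \<or> (x, w) \<in> conn F then (v, y) \<in> conn F \<or> (w, y) \<in> conn F else (x, y) \<in> conn F)" for y
  proof
    assume "(x, y) \<in> conn ?G"
    from conn_insert_cases[OF this] show "if (x, v) \<in> conn F \<or> (x, w) \<in> conn F
       then (v, y) \<in> conn F \<or> (w, y) \<in> conn F else (x, y) \<in> conn F"
      by (smt (verit) conn_sym conn_trans)
  next
    assume *: "if (x, v) \<in> conn F \<or> (x, w) \<in> conn F
       then (v, y) \<in> conn F \<or> (w, y) \<in> conn F else (x, y) \<in> conn F"
    show "(x, y) \<in> conn ?G"
    proof (cases "(x, v) \<in> conn F \<or> (x, w) \<in> conn F")
      case True
      with * have "(v, y) \<in> conn ?G \<or> (w, y) \<in> conn ?G" "(x, v) \<in> conn ?G \<or> (x, w) \<in> conn ?G"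
        using sub by auto
      then show ?thesis using vw by (meson conn_trans)
    qed (use * sub in auto)
  qed
  show ?thesis by (rule set_eqI) (simp add: iff)
qed

lemma comps_insert:
  assumes vw: "(v, w) \<notin> conn F" and V: "v \<in> V" "w \<in> V" and "finite V"
  shows "card (comps V F) = Suc (card (comps V (insert {v, w} F)))"
proof -
  let ?C = "\<lambda>x. conn F `` {x}"
  \<comment> \<open>The components untouched by the new edge; they occur in both component sets, so
    the counts differ only by the merging of two classes into one.\<close>
  define R where "R = comps V F - {?C v, ?C w}"
  have ne: "?C v \<noteq> ?C w" using vw comp_eq_iff by metis
  have 1: "comps V F = insert (?C v) (insert (?C w) R)"
  proof -
    have "?C v \<in> comps V F" "?C w \<in> comps V F" using V unfolding comps_def by simp_all
    then show ?thesis unfolding R_def by blast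
  qed
  have 2: "comps V (insert {v, w} F) = insert (?C v \<union> ?C w) R"
  proof (rule set_eqI)
    fix Z
    have "Z \<in> comps V (insert {v, w} F) \<longleftrightarrow>
      (\<exists>x\<in>V. Z = (if (x, v) \<in> conn F \<or> (x, w) \<in> conn F then ?C v \<union> ?C w else ?C x))"
      unfolding comps_def image_iff comp_insert[OF vw] by simp
    also have "\<dots> \<longleftrightarrow> Z = ?C v \<union> ?C w \<or> (\<exists>x\<in>V. Z = ?C x \<and> \<not> ((x, v) \<in> conn F \<or> (x, w) \<in> conn F))"
      (is "_ \<longleftrightarrow> _ \<or> ?E")
    proof -
      have "(v, v) \<in> conn F \<or> (v, w) \<in> conn F" by simp
      then show ?thesis using V(1) by (auto split: if_splits)
    qed
    also have "?E \<longleftrightarrow> Z \<in> R"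
    proof -
      have "(x, y) \<in> conn F \<longleftrightarrow> ?C x = ?C y" for x y by (simp only: comp_eq_iff)
      then show ?thesis unfolding R_def comps_def by auto
    qed
    also have "Z = ?C v \<union> ?C w \<or> Z \<in> R \<longleftrightarrow> Z \<in> insert (?C v \<union> ?C w) R" by simp
    finally show "Z \<in> comps V (insert {v, w} F) \<longleftrightarrow> Z \<in> insert (?C v \<union> ?C w) R" .
  qed
  have 3: "?C v \<union> ?C w \<notin> R"
  proof
    assume "?C v \<union> ?C w \<in> R"
    then have "?C v \<union> ?C w \<in> comps V F" unfolding R_def by (rule DiffD1)
    then obtain x where x: "?C v \<union> ?C w = ?C x" unfolding comps_def by (rule imageE)
    have "v \<in> ?C v \<union> ?C w" "w \<in> ?C v \<union> ?C w" by simp_all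
    then have "(x, v) \<in> conn F" "(x, w) \<in> conn F" unfolding x by simp_all
    then show False using vw by (meson conn_sym conn_trans)
  qed
  have fin: "finite R" using \<open>finite V\<close> by (simp add: R_def comps_def)
  have "?C v \<notin> R" "?C w \<notin> R" by (simp_all add: R_def)
  then show ?thesis unfolding 1 2 using fin 3 ne by simp
qed

text \<open>The empty forest has \<open>card V\<close> singleton components, and each further edge,
  being a bridge, merges two of them.\<close>

lemma forest_card:
  assumes "finite F" "forest F" "finite V" "\<And>e. e \<in> F \<Longrightarrow> e \<subseteq> V \<and> card e = 2"
  shows "card F + card (comps V F) = card V"
  using assms
proof (induction F rule: finite_induct)
  case empty
  have "conn {} = (Id :: ('a \<times> 'a) set)" by (simp add: conn_def)
  then have "comps V {} = (\<lambda>v. {v}) ` V" by (simp add: comps_def)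
  then show ?case by (simp add: card_image)
next
  case (insert e F)
  obtain v w where e: "e = {v, w}" using insert.prems(3)[of e] by (auto simp: card_2_iff)
  have "(v, w) \<notin> conn F"
    using insert.prems(1) insert.hyps(2) unfolding forest_def e
    by (metis Diff_insert_absorb insertI1)
  moreover have "v \<in> V" "w \<in> V" using insert.prems(3)[of e] e by auto
  ultimately have "card (comps V F) = Suc (card (comps V (insert e F)))"
    unfolding e using insert.prems(2) by (intro comps_insert)
  moreover have "card F + card (comps V F) = card V"
    using insert.prems by (intro insert.IH forest_subset[OF insert.prems(1)]) auto
  ultimately show ?case using insert.hyps by simp
qed

section \<open>Tree packing\<close>

definition packing :: "'a set set \<Rightarrow> nat \<Rightarrow> (nat \<Rightarrow> 'a set set) \<Rightarrow> bool" where
  "packing E k F \<longleftrightarrow> (\<forall>i<k. F i \<subseteq> E \<and> forest (F i)) \<and>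
     (\<forall>i<k. \<forall>j<k. i \<noteq> j \<longrightarrow> F i \<inter> F j = {})"

definition uncovered :: "'a set set \<Rightarrow> nat \<Rightarrow> (nat \<Rightarrow> 'a set set) \<Rightarrow> 'a set set" where
  "uncovered E k F = E - (\<Union>i<k. F i)"

definition covered_size :: "nat \<Rightarrow> (nat \<Rightarrow> 'a set set) \<Rightarrow> nat" where
  "covered_size k F = (\<Sum>i<k. card (F i))"

text \<open>The packings reachable from \<open>F\<^sub>0\<close> by swapping an uncovered edge for a
  covered one in a single forest, as in the augmentation argument for matroid union.\<close>

inductive_set exchanges :: "'a set set \<Rightarrow> nat \<Rightarrow> (nat \<Rightarrow> 'a set set) \<Rightarrow> (nat \<Rightarrow> 'a set set) set"
  for E k F\<^sub>0 where
  base: "F\<^sub>0 \<in> exchanges E k F\<^sub>0"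
| step: "F \<in> exchanges E k F\<^sub>0 \<Longrightarrow> i < k \<Longrightarrow> e \<in> uncovered E k F \<Longrightarrow> f \<in> F i \<Longrightarrow>
    F' = F(i := insert e (F i - {f})) \<Longrightarrow> packing E k F' \<Longrightarrow> F' \<in> exchanges E k F\<^sub>0"

text \<open>The components of these edges will form the partition on which the cut condition is
  tested.\<close>

definition released :: "'a set set \<Rightarrow> nat \<Rightarrow> (nat \<Rightarrow> 'a set set) \<Rightarrow> 'a set set" where
  "released E k F\<^sub>0 = (\<Union>F\<in>exchanges E k F\<^sub>0. uncovered E k F)"

lemma covered_size_upd: "i < k \<Longrightarrow> covered_size k (F(i := A)) + card (F i) = covered_size k F + card A"
  unfolding covered_size_def by (simp add: sum.remove[of "{..<k}" i])

lemma packing_upd: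
  assumes "packing E k F" "A \<subseteq> F i \<union> uncovered E k F" "forest A"
  shows "packing E k (F(i := A))"
proof -
  have "A \<inter> F j = {}" if "i < k" "j < k" "j \<noteq> i" for j
  proof -
    have "F i \<inter> F j = {}" using assms(1) that unfolding packing_def by simp
    moreover have "uncovered E k F \<inter> F j = {}" using that unfolding uncovered_def by blast
    ultimately show ?thesis using assms(2) by blast
  qed
  moreover have "A \<subseteq> E" if "i < k"
  proof -
    have "F i \<subseteq> E" using assms(1) that unfolding packing_def by simp
    then show ?thesis using assms(2) unfolding uncovered_def by blast
  qed
  ultimately show ?thesis
    using assms(1,3) unfolding packing_def by (simp add: Int_commute)
qed

section \<open>The exchange argument for maximum forest packings\<close>

locale max_packing =
  fixes E :: "'a set set" and k :: nat and F\<^sub>0 :: "nat \<Rightarrow> 'a set set"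
  assumes fin: "finite E" and card2: "\<And>e. e \<in> E \<Longrightarrow> card e = 2"
    and pack: "packing E k F\<^sub>0" and max: "\<And>F. packing E k F \<Longrightarrow> covered_size k F \<le> covered_size k F\<^sub>0"
begin

text \<open>A swap adds one edge and drops one, so every reachable packing is again maximum and
  maximality can be applied to it.\<close>

lemma exchanges_packing:
  assumes "F \<in> exchanges E k F\<^sub>0"
  shows "packing E k F \<and> covered_size k F = covered_size k F\<^sub>0"
  using assms
proof induction
  case base
  then show ?case using pack by simp
next
  case (step F i e f F')
  have "F i \<subseteq> E" using step.IH \<open>i < k\<close> unfolding packing_def by simp
  then have "finite (F i)" using fin by (rule finite_subset)
  moreover have "e \<notin> F i"
    using \<open>e \<in> uncovered E k F\<close> \<open>i < k\<close> unfolding uncovered_def by blast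
  ultimately have "card (insert e (F i - {f})) = card (F i)"
    using card_Suc_Diff1[OF _ \<open>f \<in> F i\<close>] by simp
  then have "covered_size k F' = covered_size k F\<^sub>0"
    unfolding step.hyps(5)
    using step.IH covered_size_upd[OF \<open>i < k\<close>, of F "insert e (F i - {f})"] by simp
  then show ?case using step.hyps(6) by simp
qed

text \<open>
  An uncovered edge can replace every edge on the path joining its ends in \<open>F i\<close>, so that whole path
  is released.
\<close>

lemma uncovered_connected:
  assumes F: "F \<in> exchanges E k F\<^sub>0" and e: "{v, w} \<in> uncovered E k F" and i: "i < k"
  shows "(v, w) \<in> conn (F i \<inter> released E k F\<^sub>0)"
proof -
  note p = exchanges_packing[OF F]
  have FE: "F i \<subseteq> E" and forest: "forest (F i)" using p i by (auto simp: packing_def)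
  then have finF: "finite (F i)" using fin finite_subset by blast
  have eF: "{v, w} \<notin> F i" using e i by (auto simp: uncovered_def)
  \<comment> \<open>Otherwise \<open>F i\<close> could absorb the uncovered edge, giving a packing
    larger than the maximum.\<close>
  have c: "(v, w) \<in> conn (F i)"
  proof (rule ccontr)
    assume "(v, w) \<notin> conn (F i)"
    then have "forest (insert {v, w} (F i))" by (rule forest_insert[OF forest])
    then have "packing E k (F(i := insert {v, w} (F i)))"
      using p e by (intro packing_upd) auto
    from max[OF this] show False
      using p covered_size_upd[OF i, of F "insert {v, w} (F i)"] finF eF by simp
  qed
  obtain P where P: "P \<subseteq> F i" "(v, w) \<in> conn P" "\<And>f. f \<in> P \<Longrightarrow> (v, w) \<notin> conn (P - {f})"
    using minimal_conn_subset[OF finF c] by metis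
  have "P \<subseteq> released E k F\<^sub>0"
  proof
    fix f assume f: "f \<in> P"
    then have fF: "f \<in> F i" using P(1) by auto
    have "(v, w) \<notin> conn (F i - {f})"
      by (rule forest_unique_connection[OF forest P(1) P(3) P(2) f]) (use fF FE card2 in auto)
    then have fo: "forest (insert {v, w} (F i - {f}))"
      by (intro forest_insert forest_subset[OF forest]) auto
    define F' where "F' = F(i := insert {v, w} (F i - {f}))"
    have "packing E k F'"
      unfolding F'_def using p e fo by (intro packing_upd) auto
    then have "F' \<in> exchanges E k F\<^sub>0"
      by (rule exchanges.step[OF F i e fF F'_def])
    moreover have "f \<in> uncovered E k F'"
    proof -
      have "f \<noteq> {v, w}" using fF eF by auto
      moreover have "f \<notin> F j" if "j < k" "j \<noteq> i" for j
        using p i that fF unfolding packing_def by (meson disjoint_iff)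
      ultimately show ?thesis using fF FE by (auto simp: F'_def uncovered_def split: if_splits)
    qed
    ultimately show "f \<in> released E k F\<^sub>0" unfolding released_def UN_iff by blast
  qed
  then have "conn P \<subseteq> conn (F i \<inter> released E k F\<^sub>0)" using P(1) by (intro conn_mono) auto
  then show ?thesis using P(2) by (rule subsetD)
qed

text \<open>A swap brings in an edge whose ends are already joined by released edges of the old
  forest (\<open>uncovered_connected\<close>), so it creates no new connection among released
  edges.\<close>

lemma exchanges_conn:
  assumes "F \<in> exchanges E k F\<^sub>0" "j < k"
  shows "conn (F j \<inter> released E k F\<^sub>0) \<subseteq> conn (F\<^sub>0 j \<inter> released E k F\<^sub>0)"
  using assms
proof induction
  case base
  then show ?case by simp
next
  case (step F i e f F')
  show ?case
  proof (cases "j = i")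
    case True
    let ?X = "F i \<inter> released E k F\<^sub>0"
    have "conn (insert e (F i - {f}) \<inter> released E k F\<^sub>0) \<subseteq> conn ?X"
    proof (rule conn_subset)
      fix a b assume ab: "{a, b} \<in> insert e (F i - {f}) \<inter> released E k F\<^sub>0"
      show "(a, b) \<in> conn ?X"
      proof (cases "{a, b} = e")
        case True
        then show ?thesis using uncovered_connected[OF step.hyps(1) _ step.hyps(2)] step.hyps(3) by simp
      next
        case False
        then show ?thesis using ab by (intro conn_edge) auto
      qed
    qed
    then show ?thesis using step True by simp
  next
    case False
    then show ?thesis using step by simp
  qed
qed

lemma released_connected:
  assumes "{a, b} \<in> released E k F\<^sub>0" "i < k"
  shows "(a, b) \<in> conn (F\<^sub>0 i \<inter> released E k F\<^sub>0)"
proof -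
  obtain F where F: "F \<in> exchanges E k F\<^sub>0" "{a, b} \<in> uncovered E k F"
    using assms(1) unfolding released_def by (rule UN_E)
  show ?thesis using uncovered_connected[OF F assms(2)] exchanges_conn[OF F(1) assms(2)] by (rule rev_subsetD)
qed

text \<open>Within the released edges all \<open>k\<close> forests have the same components; this
  makes the count in \<open>tree_packing\<close> exact.\<close>

lemma released_conn:
  assumes "i < k"
  shows "conn (F\<^sub>0 i \<inter> released E k F\<^sub>0) = conn (released E k F\<^sub>0)"
proof
  show "conn (F\<^sub>0 i \<inter> released E k F\<^sub>0) \<subseteq> conn (released E k F\<^sub>0)" by (rule conn_mono) auto
  show "conn (released E k F\<^sub>0) \<subseteq> conn (F\<^sub>0 i \<inter> released E k F\<^sub>0)"
    by (rule conn_subset) (rule released_connected[OF _ assms])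
qed

end

lemma max_packing_exists:
  assumes "finite E"
  obtains F where "packing E k F" "\<And>F'. packing E k F' \<Longrightarrow> covered_size k F' \<le> covered_size k F"
proof -
  have ex: "packing E k (\<lambda>_. {})" by (simp add: packing_def forest_def)
  have bound: "covered_size k F \<le> k * card E" if "packing E k F" for F
  proof -
    have "covered_size k F \<le> (\<Sum>i<k. card E)" unfolding covered_size_def
      using that assms by (intro sum_mono card_mono) (auto simp: packing_def)
    then show ?thesis by simp
  qed
  have "\<exists>F. packing E k F \<and> (\<forall>F'. packing E k F' \<longrightarrow> covered_size k F' \<le> covered_size k F)"
    by (rule ex_has_greatest_nat[where b = "Suc (k * card E)"]) (use ex bound in \<open>auto simp: less_Suc_eq_le\<close>)
  then show thesis using that by metis
qed

text \<open>The sufficiency half of the Nash-Williams--Tutte theorem. For the partition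
  \<open>P\<close> into components of the released edges of a maximum packing, each forest has
  \<open>card V - card P\<close> released edges, and all edges crossing \<open>P\<close> are covered
  but not released. The cut condition then gives at least \<open>k * (card V - 1)\<close> covered
  edges, so every forest spans.\<close>

theorem tree_packing:
  fixes E :: "'a set set"
  assumes V: "finite V" "V \<noteq> {}" and E: "\<And>e. e \<in> E \<Longrightarrow> e \<subseteq> V \<and> card e = 2"
    and cuts: "\<And>P. partition_on V P \<Longrightarrow> k * (card P - 1) \<le> card {e \<in> E. \<not> (\<exists>X\<in>P. e \<subseteq> X)}"
  obtains F where "\<And>i. i < k \<Longrightarrow> F i \<subseteq> E"
    "\<And>i j. i < k \<Longrightarrow> j < k \<Longrightarrow> i \<noteq> j \<Longrightarrow> F i \<inter> F j = {}"
    "\<And>i u v. i < k \<Longrightarrow> u \<in> V \<Longrightarrow> v \<in> V \<Longrightarrow> (u, v) \<in> conn (F i)"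
proof -
  have finE: "finite E" using E V(1) by (intro finite_subset[of E "Pow V"]) auto
  obtain F where F: "packing E k F" and Fmax: "\<And>F'. packing E k F' \<Longrightarrow> covered_size k F' \<le> covered_size k F"
    using max_packing_exists[OF finE] by metis
  interpret max_packing E k F
    by unfold_locales (use finE E F Fmax in auto)
  let ?R = "released E k F"
  have RE: "?R \<subseteq> E" by (auto simp: released_def uncovered_def)
  define P where "P = comps V ?R"
  have FE: "F i \<subseteq> E" "forest (F i)" "finite (F i)" if "i < k" for i
  proof -
    show *: "F i \<subseteq> E" "forest (F i)" using F that unfolding packing_def by simp_all
    show "finite (F i)" using *(1) finE by (rule finite_subset)
  qed
  have part: "partition_on V P" unfolding P_def using RE E by (intro comps_partition) blast
  have P0: "card P > 0" unfolding P_def comps_def using V by (simp add: card_gt_0_iff)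
  have Rcard: "card (F i \<inter> ?R) + card P = card V" if "i < k" for i
  proof -
    have "card (F i \<inter> ?R) + card (comps V (F i \<inter> ?R)) = card V"
      using FE[OF that] E V by (intro forest_card forest_subset[OF FE(2)[OF that]]) auto
    then show ?thesis by (simp add: P_def comps_def released_conn[OF that])
  qed
  have Fcard: "card (F i) + card (comps V (F i)) = card V" if "i < k" for i
    using FE[OF that] E V by (intro forest_card) auto
  \<comment> \<open>A released edge lies inside one class of \<open>P\<close>. A crossing edge is
    therefore not released, and in particular the packing \<open>F\<close> itself covers it.\<close>
  have cross: "{e \<in> E. \<not> (\<exists>X\<in>P. e \<subseteq> X)} \<subseteq> (\<Union>i<k. F i - ?R)"
  proof
    fix e assume e: "e \<in> {e \<in> E. \<not> (\<exists>X\<in>P. e \<subseteq> X)}"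
    obtain a b where ab: "e = {a, b}" using E[of e] e by (auto simp: card_2_iff)
    have "e \<notin> ?R"
    proof
      assume "e \<in> ?R"
      then have "(a, b) \<in> conn ?R" unfolding ab by (rule conn_edge)
      then have "e \<subseteq> conn ?R `` {a}" by (simp add: ab)
      moreover have "conn ?R `` {a} \<in> P" unfolding P_def comps_def using E e ab by auto
      ultimately show False using e by blast
    qed
    moreover have "e \<notin> uncovered E k F"
      using \<open>e \<notin> ?R\<close> exchanges.base[of F E k] unfolding released_def UN_iff by blast
    ultimately show "e \<in> (\<Union>i<k. F i - ?R)" using e by (auto simp: uncovered_def)
  qed
  have "k * (card P - 1) \<le> card (\<Union>i<k. F i - ?R)"
  proof -
    have "finite (\<Union>i<k. F i - ?R)" using FE(3) by simp
    from card_mono[OF this cross] show ?thesis using cuts[OF part] by linarith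
  qed
  also have "\<dots> \<le> (\<Sum>i<k. card (F i - ?R))" by (rule card_UN_le) simp
  also have "(\<Sum>i<k. card (F i - ?R)) + k * (card V - card P) = covered_size k F"
  proof -
    have "card (F i) = card (F i - ?R) + (card V - card P)" if "i < k" for i
      using Rcard[OF that] card_Diff_subset_Int[of "F i" ?R] card_mono[of "F i" "F i \<inter> ?R"] FE[OF that]
      by simp
    then show ?thesis by (simp add: covered_size_def sum.distrib)
  qed
  finally have total: "k * (card P - 1) + k * (card V - card P) \<le> covered_size k F" by simp
  \<comment> \<open>No forest has more than \<open>card V - 1\<close> edges, so a single deficient
    forest would push the total below the bound just obtained.\<close>
  have comps1: "card (comps V (F i)) = 1" if i: "i < k" for i
  proof (rule ccontr)
    have pos: "card (comps V (F j)) > 0" for j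
      unfolding comps_def using V by (simp add: card_gt_0_iff)
    assume "card (comps V (F i)) \<noteq> 1"
    then have lt: "card (F i) < card V - 1" using Fcard[OF i] pos[of i] by linarith
    have le: "card (F j) \<le> card V - 1" if "j < k" for j using Fcard[OF that] pos[of j] by linarith
    have "covered_size k F < (\<Sum>j<k. card V - 1)"
      unfolding covered_size_def by (rule sum_strict_mono_ex1) (use le lt i in auto)
    also have "\<dots> = k * (card V - 1)" by simp
    also have "\<dots> = k * ((card P - 1) + (card V - card P))"
      using P0 Rcard[OF i] by simp
    finally show False using total by (simp add: algebra_simps)
  qed
  show thesis
  proof (rule that[of F])
    show "F i \<subseteq> E" if "i < k" for i using FE that by simp
    show "F i \<inter> F j = {}" if "i < k" "j < k" "i \<noteq> j" for i j using F that by (auto simp: packing_def)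
    show "(u, v) \<in> conn (F i)" if i: "i < k" and u: "u \<in> V" and v: "v \<in> V" for i u v
    proof -
      obtain C where C: "comps V (F i) = {C}" using comps1[OF i] by (rule card_1_singletonE)
      have "conn (F i) `` {u} \<in> comps V (F i)" "conn (F i) `` {v} \<in> comps V (F i)"
        using u v by (simp_all add: comps_def)
      then have "conn (F i) `` {u} = conn (F i) `` {v}" unfolding C by (simp only: singleton_iff)
      then show ?thesis by (simp add: comp_eq_iff)
    qed
  qed
qed

section \<open>Trees given by parent functions\<close>

lemma path_edges_single [simp]: "path_edges [x] = {}"
  by (simp add: path_edges_def)

lemma path_edges_Cons: "path_edges (x # y # p) = insert {x, y} (path_edges (y # p))"
proof (intro equalityI subsetI)
  fix e assume "e \<in> path_edges (x # y # p)"
  then obtain i where i: "Suc i < length (x # y # p)" "e = {(x # y # p) ! i, (x # y # p) ! Suc i}"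
    unfolding path_edges_def by auto
  show "e \<in> insert {x, y} (path_edges (y # p))"
  proof (cases i)
    case (Suc j)
    then show ?thesis using i unfolding path_edges_def by auto
  qed (use i in simp)
next
  fix e assume "e \<in> insert {x, y} (path_edges (y # p))"
  then consider "e = {x, y}" | i where "Suc i < length (y # p)" "e = {(y # p) ! i, (y # p) ! Suc i}"
    unfolding path_edges_def by auto
  then show "e \<in> path_edges (x # y # p)"
  proof cases
    case 1
    then show ?thesis unfolding path_edges_def by (auto intro!: exI[of _ 0])
  next
    case (2 i)
    then show ?thesis unfolding path_edges_def by (auto intro!: exI[of _ "Suc i"])
  qed
qed

lemma path_edges_suffix: "q \<noteq> [] \<Longrightarrow> path_edges q \<subseteq> path_edges (p @ q)"
proof (induction p)
  case (Cons a p)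
  then have IH: "path_edges q \<subseteq> path_edges (p @ q)" by simp
  obtain b s where "p @ q = b # s" using Cons.prems by (cases "p @ q") auto
  then show ?case using IH path_edges_Cons[of a b s] by auto
qed simp

lemma path_conn: "p \<noteq> [] \<Longrightarrow> path_edges p \<subseteq> X \<Longrightarrow> (hd p, last p) \<in> conn X"
proof (induction p)
  case (Cons a p)
  show ?case
  proof (cases p)
    case (Cons b q)
    then have "{a, b} \<in> X" "path_edges p \<subseteq> X" using Cons.prems path_edges_Cons[of a b q] by auto
    then have "(a, b) \<in> conn X" "(b, last p) \<in> conn X"
      using Cons.IH Cons by (auto intro: conn_edge)
    then show ?thesis using Cons by (auto intro: conn_trans)
  qed simp
qed simp

text \<open>A walk becomes a path by cutting back to the suffix at a vertex that is met
  again.\<close>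

lemma conn_path:
  assumes "(u, v) \<in> conn (edges G)" "\<And>e. e \<in> edges G \<Longrightarrow> e \<subseteq> vertices G" "u \<in> vertices G"
  shows "\<exists>p. is_path G u p v"
proof -
  \<comment> \<open>Reversing the walk lets the induction extend the path at the head of its
    list.\<close>
  have "(v, u) \<in> conn (edges G)" using assms(1) by (rule conn_sym)
  moreover have "v \<in> vertices G" using assms by (rule conn_closed)
  ultimately show ?thesis
  proof (induction rule: conn_induct)
    case base
    then show ?case by (intro exI[of _ "[v]"]) (simp add: is_path_def)
  next
    case (step y z)
    then obtain p where p: "is_path G y p v" by blast
    have z: "z \<in> vertices G" using assms(2)[OF step.hyps(2)] by simp
    obtain q where q: "p = y # q" using p by (cases p) (auto simp: is_path_def)
    show ?case
    proof (cases "z \<in> set p")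
      case True
      then obtain xs ys where xy: "p = xs @ z # ys" by (meson split_list)
      have "path_edges (z # ys) \<subseteq> edges G"
        using path_edges_suffix[of "z # ys" xs] p unfolding xy is_path_def by blast
      then have "is_path G z (z # ys) v" using p unfolding xy is_path_def by simp
      then show ?thesis by blast
    next
      case False
      have "{z, y} \<in> edges G" using step.hyps(2) by (simp add: insert_commute)
      then have "is_path G z (z # p) v"
        using p False z unfolding q is_path_def by (simp add: path_edges_Cons)
      then show ?thesis by blast
    qed
  qed
qed

lemma path_interior:
  assumes "distinct p" "x \<in> set p" "x \<noteq> hd p" "x \<noteq> last p"
  obtains y z where "y \<noteq> z" "{x, y} \<in> path_edges p" "{x, z} \<in> path_edges p"
proof -
  obtain i where i: "i < length p" "x = p ! i" using assms(2) by (auto simp: in_set_conv_nth)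
  have p: "p \<noteq> []" using i by auto
  have "i \<noteq> 0" using i assms(3) p by (metis hd_conv_nth)
  then obtain j where j: "i = Suc j" by (cases i) auto
  have "i \<noteq> length p - 1" using i assms(4) p by (auto simp: last_conv_nth)
  then have Si: "Suc i < length p" using i by simp
  show thesis
  proof (rule that[of "p ! j" "p ! Suc i"])
    show "p ! j \<noteq> p ! Suc i" using assms(1) Si j by (simp add: nth_eq_iff_index_eq)
    have "{p ! j, p ! Suc j} \<in> path_edges p" using i j unfolding path_edges_def by blast
    then show "{x, p ! j} \<in> path_edges p" using i j by (simp add: insert_commute)
    show "{x, p ! Suc i} \<in> path_edges p" using i Si unfolding path_edges_def by blast
  qed
qed

lemma cycle_neighbours:
  assumes "is_cycle G c" "x \<in> set c"
  obtains y z where "y \<noteq> z" "y \<in> set c" "z \<in> set c" "{x, y} \<in> edges G" "{x, z} \<in> edges G"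
proof -
  obtain i where i: "i < length c" "x = c ! i" using assms(2) by (auto simp: in_set_conv_nth)
  have c: "3 \<le> length c" "distinct c" "path_edges c \<subseteq> edges G" "{last c, hd c} \<in> edges G"
    using assms(1) by (auto simp: is_cycle_def)
  have ne: "c \<noteq> []" using c(1) by auto
  define n where "n = length c"
  have wrap: "{c ! (n - 1), c ! 0} \<in> edges G"
    using c(4) ne by (simp add: last_conv_nth hd_conv_nth n_def)
  have nxt: "{c ! j, c ! Suc j} \<in> edges G" if "Suc j < n" for j
    using c(3) that unfolding path_edges_def n_def by blast
  \<comment> \<open>The cyclic successor and predecessor of \<open>i\<close>; they differ because
    the cycle has at least three vertices.\<close>
  define a where "a = (if Suc i < n then Suc i else 0)"
  define b where "b = (if i = 0 then n - 1 else i - 1)"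
  have n3: "3 \<le> n" "i < n" using c i by (auto simp: n_def)
  have ab: "a < n" "b < n" "a \<noteq> b" using n3 by (auto simp: a_def b_def)
  show thesis
  proof (rule that[of "c ! a" "c ! b"])
    show "c ! a \<noteq> c ! b" using ab c(2) by (simp add: nth_eq_iff_index_eq n_def)
    show "c ! a \<in> set c" "c ! b \<in> set c" using ab by (auto simp: n_def)
    show "{x, c ! a} \<in> edges G"
    proof (cases "Suc i < n")
      case True
      then show ?thesis using nxt[of i] i by (simp add: a_def)
    next
      case False
      then have "i = n - 1" using n3 by simp
      then show ?thesis using wrap i False by (simp add: a_def)
    qed
    show "{x, c ! b} \<in> edges G"
    proof (cases i)
      case 0
      then show ?thesis using wrap i by (simp add: b_def insert_commute)
    next
      case (Suc j)
      then show ?thesis using nxt[of j] i n3 by (simp add: b_def insert_commute)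
    qed
  qed
qed

definition parent_graph :: "'a set \<Rightarrow> 'a \<Rightarrow> ('a \<Rightarrow> 'a) \<Rightarrow> 'a ugraph" where
  "parent_graph W r f = \<lparr>vertices = W, edges = (\<lambda>v. {v, f v}) ` (W - {r})\<rparr>"

lemma parent_graph_simps [simp]:
  "vertices (parent_graph W r f) = W"
  "edges (parent_graph W r f) = (\<lambda>v. {v, f v}) ` (W - {r})"
  by (simp_all add: parent_graph_def)

lemma parent_edge_cases:
  assumes "{x, y} \<in> edges (parent_graph W r f)"
  shows "y = f x \<and> x \<in> W - {r} \<or> x = f y \<and> y \<in> W - {r}"
  using assms by (auto simp: doubleton_eq_iff)

text \<open>Following parents lowers the rank and so ends at the root, which gives connectedness. A
  vertex of maximum rank on a cycle would have two distinct neighbours there, both of which must be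
  its parent.\<close>

lemma parent_graph_tree:
  fixes rank :: "'a \<Rightarrow> nat"
  assumes W: "finite W" "r \<in> W"
    and f: "\<And>v. v \<in> W \<Longrightarrow> v \<noteq> r \<Longrightarrow> f v \<in> W \<and> rank (f v) < rank v"
  shows "is_tree (parent_graph W r f)" (is "is_tree ?T")
proof -
  have sub: "e \<subseteq> W" if "e \<in> edges ?T" for e using that f by auto
  have "card {v, f v} = 2" if "v \<in> W - {r}" for v
  proof -
    have "v \<noteq> f v" using f[of v] that by auto
    then show ?thesis by simp
  qed
  then have simple: "simple_graph ?T"
    unfolding simple_graph_def using W(1) sub by auto
  have root: "(v, r) \<in> conn (edges ?T)" if "v \<in> W" for v
    using that
  proof (induction v rule: measure_induct_rule[of rank])
    case (less v)
    show ?case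
    proof (cases "v = r")
      case False
      then have "(f v, r) \<in> conn (edges ?T)" using less f by simp
      moreover have "(v, f v) \<in> conn (edges ?T)" using False less.prems by (intro conn_edge) simp
      ultimately show ?thesis by (rule conn_trans[rotated])
    qed simp
  qed
  have "connected_graph ?T"
    unfolding connected_graph_def
  proof (intro conjI ballI)
    show "vertices ?T \<noteq> {}" using W by auto
    fix u v assume uv: "u \<in> vertices ?T" "v \<in> vertices ?T"
    then have "(u, r) \<in> conn (edges ?T)" "(r, v) \<in> conn (edges ?T)"
      using root[of u] conn_sym[OF root[of v]] by simp_all
    then have "(u, v) \<in> conn (edges ?T)" by (rule conn_trans)
    then show "\<exists>p. is_path ?T u p v" by (rule conn_path) (use sub uv in auto)
  qed
  moreover have "\<nexists>c. is_cycle ?T c"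
  proof
    assume "\<exists>c. is_cycle ?T c"
    then obtain c where c: "is_cycle ?T c" by blast
    have "set c \<noteq> {}" using c by (auto simp: is_cycle_def)
    then obtain x where x: "x \<in> set c" "\<And>y. y \<in> set c \<Longrightarrow> rank y \<le> rank x"
      using obtains_MAX[of "set c" rank] by (metis List.finite_set Max_ge finite_imageI imageI)
    obtain y z where yz: "y \<noteq> z" "y \<in> set c" "z \<in> set c" "{x, y} \<in> edges ?T" "{x, z} \<in> edges ?T"
      using cycle_neighbours[OF c x(1)] by metis
    have up: "w = f x" if "w \<in> set c" "{x, w} \<in> edges ?T" for w
      using parent_edge_cases[OF that(2)] f[of w] x(2)[OF that(1)] by auto
    show False using up[OF yz(2,4)] up[OF yz(3,5)] yz(1) by simp
  qed
  ultimately show ?thesis using simple by (simp add: is_tree_def)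
qed

text \<open>An interior vertex has two distinct neighbours on the path. At most one is its parent,
  so the other is a child.\<close>

lemma parent_graph_path_interior:
  assumes p: "is_path (parent_graph W r f) u p v" and x: "x \<in> set p" "x \<noteq> u" "x \<noteq> v"
  shows "\<exists>w\<in>W - {r}. x = f w"
proof -
  let ?T = "parent_graph W r f"
  have d: "distinct p" "hd p = u" "last p = v" "path_edges p \<subseteq> edges ?T"
    using p unfolding is_path_def by simp_all
  obtain y z where "y \<noteq> z" "{x, y} \<in> path_edges p" "{x, z} \<in> path_edges p"
    using path_interior[OF d(1) x(1)] d(2,3) x(2,3) by metis
  then show ?thesis
    using parent_edge_cases[of x y W r f] parent_edge_cases[of x z W r f] d(4) by blast
qed

text \<open>
  The map \<open>cl\<close> records the part of a CIST partition: every vertex that is the parent of another one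
  in the \<open>i\<close>-th tree has class \<open>i\<close>, so the inner vertices of the trees are disjoint.
\<close>

lemma has_cists_by_parents:
  fixes rank :: "nat \<Rightarrow> 'a \<Rightarrow> nat"
  assumes fin: "finite (vertices H)"
    and root: "\<And>i. i < k \<Longrightarrow> r i \<in> vertices H"
    and f: "\<And>i v. i < k \<Longrightarrow> v \<in> vertices H \<Longrightarrow> v \<noteq> r i \<Longrightarrow>
      f i v \<in> vertices H \<and> {v, f i v} \<in> edges H \<and> rank i (f i v) < rank i v \<and> cl (f i v) = i"
    and mutual: "\<And>i j v w. i < k \<Longrightarrow> j < k \<Longrightarrow> i \<noteq> j \<Longrightarrow> v \<in> vertices H \<Longrightarrow> w \<in> vertices H \<Longrightarrow>
      v \<noteq> r i \<Longrightarrow> w \<noteq> r j \<Longrightarrow> f i v = w \<Longrightarrow> f j w = v \<Longrightarrow> False"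
  shows "has_cists H k"
proof -
  define T where "T i = parent_graph (vertices H) (r i) (f i)" for i
  have disj: "edges (T i) \<inter> edges (T j) = {}" if ij: "i < k" "j < k" "i \<noteq> j" for i j
  proof (rule ccontr)
    assume "edges (T i) \<inter> edges (T j) \<noteq> {}"
    then obtain v w where v: "v \<in> vertices H" "v \<noteq> r i" and w: "w \<in> vertices H" "w \<noteq> r j"
      and eq: "{v, f i v} = {w, f j w}" by (auto simp: T_def)
    \<comment> \<open>With equal orientation the common parent would have both class
      \<open>i\<close> and class \<open>j\<close>; the reversed orientation is what
      \<open>mutual\<close> forbids.\<close>
    from eq consider "f i v = f j w" | "f i v = w" "f j w = v" by (auto simp: doubleton_eq_iff)
    then show False
    proof cases
      case 1
      then show False using f[OF ij(1) v] f[OF ij(2) w] ij(3) by simp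
    next
      case 2
      then show False using mutual[OF ij v(1) w(1) v(2) w(2)] by simp
    qed
  qed
  have inner: "cl x = i" if "i < k" "is_path (T i) u p v" "x \<in> set p" "x \<noteq> u" "x \<noteq> v" for i u p v x
    using parent_graph_path_interior[OF that(2)[unfolded T_def] that(3-5)] f[OF that(1)] by auto
  have "completely_independent_spanning_trees H k T"
    unfolding completely_independent_spanning_trees_def
  proof (intro conjI allI ballI impI; (elim conjE)?)
    fix i assume i: "i < k"
    have "is_tree (T i)"
      unfolding T_def by (rule parent_graph_tree[where rank = "rank i", OF fin root[OF i]]) (use f[OF i] in blast)
    then show "is_spanning_tree (T i) H"
      unfolding is_spanning_tree_def using f[OF i] by (auto simp: T_def)
  next
    fix u v i j p q
    assume ij: "i < k" "j < k" "i \<noteq> j" and p: "is_path (T i) u p v" and q: "is_path (T j) u q v"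
    show "path_edges p \<inter> path_edges q = {}"
      using disj[OF ij] p q unfolding is_path_def by blast
    have "{u, v} \<subseteq> set s" if "is_path (T l) u s v" for l s
      using that unfolding is_path_def by auto
    from this[OF p] this[OF q] have "{u, v} \<subseteq> set p" "{u, v} \<subseteq> set q" .
    moreover have "x = u \<or> x = v" if "x \<in> set p" "x \<in> set q" for x
      using inner[OF ij(1) p that(1)] inner[OF ij(2) q that(2)] ij(3) by blast
    ultimately show "set p \<inter> set q = {u, v}" by blast
  qed
  then show ?thesis unfolding has_cists_def by blast
qed

section \<open>Independent trees of a line graph\<close>

text \<open>Breadth-first search: the rank is the distance to \<open>r\<close>, and the parent is
  the next vertex on a shortest walk to \<open>r\<close>.\<close>

lemma connected_rooted_tree:
  assumes F: "\<And>e. e \<in> F \<Longrightarrow> e \<subseteq> V" and conn: "\<And>v. v \<in> V \<Longrightarrow> (v, r) \<in> conn F"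
  shows "\<exists>f d. \<forall>v\<in>V - {r}. f v \<in> V \<and> {v, f v} \<in> F \<and> d (f v) < (d v :: nat)"
proof -
  define A where "A = {(a, b). {a, b} \<in> F}"
  define d where "d v = (LEAST n. (v, r) \<in> A ^^ n)" for v
  have "\<exists>y. y \<in> V \<and> {v, y} \<in> F \<and> d y < d v" if v: "v \<in> V - {r}" for v
  proof -
    have "(v, r) \<in> A\<^sup>*" using conn[of v] v by (simp add: conn_def A_def)
    then have "\<exists>n. (v, r) \<in> A ^^ n" by (simp add: rtrancl_power)
    then have dv: "(v, r) \<in> A ^^ d v" unfolding d_def by (rule LeastI_ex)
    have "d v \<noteq> 0" using dv v by (cases "d v") simp_all
    then obtain m where m: "d v = Suc m" using not0_implies_Suc by blast
    have "(v, r) \<in> A ^^ Suc m" using dv unfolding m .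
    from relpow_Suc_D2[OF this] obtain y where y: "(v, y) \<in> A" "(y, r) \<in> A ^^ m" by blast
    have "d y \<le> m" unfolding d_def by (rule Least_le) (rule y(2))
    moreover have vy: "{v, y} \<in> F" using y(1) by (simp add: A_def)
    moreover have "y \<in> V" using F[OF vy] by simp
    ultimately show ?thesis using m by (intro exI[of _ y]) simp
  qed
  then have "\<forall>v\<in>V - {r}. \<exists>y. y \<in> V \<and> {v, y} \<in> F \<and> d y < d v" by (rule ballI)
  from bchoice[OF this] obtain f where "\<forall>v\<in>V - {r}. f v \<in> V \<and> {v, f v} \<in> F \<and> d (f v) < d v"
    by (rule exE)
  then show ?thesis by (intro exI[of _ f] exI[of _ d])
qed

text \<open>Edge-disjoint spanning trees with the common root \<open>r\<close>, encoded by parent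
  functions \<open>f i\<close> that decrease the ranks \<open>d i\<close>. By
  \<open>nontrivial\<close> the root has a child in each tree.\<close>

locale rooted_trees =
  fixes V :: "'a set" and E :: "'a set set" and k :: nat and r :: 'a
    and f :: "nat \<Rightarrow> 'a \<Rightarrow> 'a" and d :: "nat \<Rightarrow> 'a \<Rightarrow> nat"
  assumes finV: "finite V" and root: "r \<in> V" and nontrivial: "V - {r} \<noteq> {}"
    and E: "\<And>e. e \<in> E \<Longrightarrow> e \<subseteq> V \<and> card e = 2"
    and f: "\<And>i v. i < k \<Longrightarrow> v \<in> V - {r} \<Longrightarrow> f i v \<in> V \<and> {v, f i v} \<in> E \<and> d i (f i v) < d i v"
    and disj: "\<And>i j v w. i < k \<Longrightarrow> j < k \<Longrightarrow> i \<noteq> j \<Longrightarrow> v \<in> V - {r} \<Longrightarrow> w \<in> V - {r} \<Longrightarrow>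
      {v, f i v} \<noteq> {w, f j w}"
begin

section \<open>The parent map on the edges of the graph\<close>

definition up_edge :: "nat \<Rightarrow> 'a \<Rightarrow> 'a set" where
  "up_edge i v = {v, f i v}"

definition tree_edges :: "nat \<Rightarrow> 'a set set" where
  "tree_edges i = up_edge i ` (V - {r})"

definition root_child :: "nat \<Rightarrow> 'a" where
  "root_child i = (SOME v. v \<in> V - {r} \<and> f i v = r)"

definition child :: "nat \<Rightarrow> 'a set \<Rightarrow> 'a" where
  "child i = inv_into (V - {r}) (up_edge i)"

text \<open>A chosen edge of the \<open>i\<close>-th tree incident with \<open>v\<close>. The root
  has no edge towards a parent, so the edge to a fixed child replaces it.\<close>

definition edge_at :: "nat \<Rightarrow> 'a \<Rightarrow> 'a set" where
  "edge_at i v = up_edge i (if v = r then root_child i else v)"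

text \<open>Serves as the class map of the CIST partition. Its value is arbitrary on edges outside
  all trees, but parents are always tree edges.\<close>

definition part :: "'a set \<Rightarrow> nat" where
  "part e = (SOME i. i < k \<and> e \<in> tree_edges i)"

text \<open>
  The asymmetry between \<open>j < i\<close> and \<open>j \<ge> i\<close> prevents an edge of the \<open>i\<close>-th and an edge of the
  \<open>j\<close>-th tree from choosing each other as parents.
\<close>

definition link :: "nat \<Rightarrow> 'a set \<Rightarrow> 'a" where
  "link i e = (if \<exists>j<k. e \<in> tree_edges j
     then (if part e < i then child (part e) e else f (part e) (child (part e) e))
     else (SOME x. x \<in> e))"

text \<open>One formula covers both roles of an edge: for an edge of the \<open>i\<close>-th tree,
  \<open>link\<close> is its upper end and the parent is the next edge towards the root; any other
  edge is hung as a leaf at one of its ends.\<close>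

definition parent :: "nat \<Rightarrow> 'a set \<Rightarrow> 'a set" where
  "parent i e = edge_at i (link i e)"

definition root_edge :: "nat \<Rightarrow> 'a set" where
  "root_edge i = up_edge i (root_child i)"

text \<open>The root edge needs rank 0 of its own, since other edges at \<open>r\<close> hang from
  it and may have a child of smaller \<open>d i\<close>. The sum bounds every \<open>d i v\<close>,
  which ranks edges outside the tree above all tree edges.\<close>

definition edge_rank :: "nat \<Rightarrow> 'a set \<Rightarrow> nat" where
  "edge_rank i e = (if e \<in> tree_edges i then if e = root_edge i then 0 else Suc (d i (child i e))
     else Suc (Suc (\<Sum>v\<in>V. d i v)))"

section \<open>Ranks decrease and no two edges choose each other\<close>

lemma root_child: assumes "i < k" shows "root_child i \<in> V - {r} \<and> f i (root_child i) = r"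
proof -
  \<comment> \<open>A non-root vertex of least rank can only have \<open>r\<close> as its
    parent.\<close>
  define v where "v = arg_min_on (d i) (V - {r})"
  have fin: "finite (V - {r})" using finV by simp
  have v: "v \<in> V - {r}" unfolding v_def by (rule arg_min_if_finite(1)[OF fin nontrivial])
  have "f i v = r"
  proof (rule ccontr)
    assume "f i v \<noteq> r"
    then have "f i v \<in> V - {r}" using f[OF assms v] by simp
    from arg_min_least[OF fin nontrivial this, of "d i"] show False
      using f[OF assms v] unfolding v_def by simp
  qed
  then have "v \<in> V - {r} \<and> f i v = r" using v by simp
  then show ?thesis unfolding root_child_def by (rule someI)
qed

text \<open>Two vertices with the same upward edge would be parents of each other, contradicting the
  ranks.\<close>

lemma up_edge_inj: assumes "i < k" shows "inj_on (up_edge i) (V - {r})"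
proof (rule inj_onI)
  fix v w assume vw: "v \<in> V - {r}" "w \<in> V - {r}" and eq: "up_edge i v = up_edge i w"
  show "v = w"
  proof (rule ccontr)
    assume "v \<noteq> w"
    then have "v = f i w" "w = f i v" using eq unfolding up_edge_def by (auto simp: doubleton_eq_iff)
    then show False using f[OF assms vw(1)] f[OF assms vw(2)] by simp
  qed
qed

lemma child_up_edge: "i < k \<Longrightarrow> v \<in> V - {r} \<Longrightarrow> child i (up_edge i v) = v"
  unfolding child_def by (rule inv_into_f_f[OF up_edge_inj])

lemma tree_edges_E: "i < k \<Longrightarrow> tree_edges i \<subseteq> E"
  unfolding tree_edges_def up_edge_def using f by auto

lemma tree_edges_disj:
  assumes "i < k" "j < k" "e \<in> tree_edges i" "e \<in> tree_edges j"
  shows "i = j"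
proof -
  obtain v where v: "e = up_edge i v" "v \<in> V - {r}" using assms(3) unfolding tree_edges_def by (rule imageE)
  obtain w where w: "e = up_edge j w" "w \<in> V - {r}" using assms(4) unfolding tree_edges_def by (rule imageE)
  show ?thesis using disj[OF assms(1,2) _ v(2) w(2)] v(1) w(1) unfolding up_edge_def by metis
qed

lemma part_eq: "i < k \<Longrightarrow> e \<in> tree_edges i \<Longrightarrow> part e = i"
  unfolding part_def by (rule some_equality) (simp, metis tree_edges_disj)

lemma up_edge_tree: "v \<in> V - {r} \<Longrightarrow> up_edge i v \<in> tree_edges i"
  by (simp add: tree_edges_def)

lemma link_up_edge:
  assumes "j < k" "v \<in> V - {r}"
  shows "link i (up_edge j v) = (if j < i then v else f j v)"
proof -
  have t: "up_edge j v \<in> tree_edges j" using assms by (simp add: up_edge_tree)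
  then show ?thesis
    unfolding link_def using assms part_eq[OF assms(1) t] child_up_edge[OF assms] by auto
qed

lemma link_in: assumes "e \<in> E" shows "link i e \<in> e"
proof (cases "\<exists>j<k. e \<in> tree_edges j")
  case True
  then obtain j v where "j < k" "v \<in> V - {r}" "e = up_edge j v" by (auto simp: tree_edges_def)
  then show ?thesis by (simp add: link_up_edge) (simp add: up_edge_def)
next
  case False
  have "e \<noteq> {}" using E[OF assms] by auto
  then show ?thesis unfolding link_def using False by (auto simp: some_in_eq)
qed

lemma edge_at_tree: "i < k \<Longrightarrow> v \<in> V \<Longrightarrow> edge_at i v \<in> tree_edges i"
  unfolding edge_at_def using root_child[of i] by (auto intro: up_edge_tree)

lemma edge_at_in: "i < k \<Longrightarrow> v \<in> edge_at i v"
  unfolding edge_at_def up_edge_def using root_child[of i] by auto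

lemma parent_tree: assumes "i < k" "e \<in> E" shows "parent i e \<in> tree_edges i"
  unfolding parent_def using link_in[OF assms(2), of i] E[OF assms(2)] by (intro edge_at_tree assms) auto

lemma rank_tree_le:
  assumes "i < k" "v \<in> V - {r}"
  shows "edge_rank i (up_edge i v) \<le> Suc (d i v)"
  unfolding edge_rank_def using assms child_up_edge[OF assms] up_edge_tree[OF assms(2)] by simp

lemma edge_rank_parent:
  assumes i: "i < k" and e: "e \<in> E" "e \<noteq> root_edge i"
  shows "edge_rank i (parent i e) < edge_rank i e"
proof (cases "e \<in> tree_edges i")
  case True
  then obtain v where v: "v \<in> V - {r}" "e = up_edge i v" by (auto simp: tree_edges_def)
  have rk: "edge_rank i e = Suc (d i v)"
    using True e(2) child_up_edge[OF i v(1)] v(2) by (simp add: edge_rank_def)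
  have par: "parent i e = edge_at i (f i v)"
    unfolding parent_def v(2) using link_up_edge[OF i v(1), of i] by simp
  \<comment> \<open>An edge whose upper end is \<open>r\<close> hangs from the root edge; otherwise
    the rank drops with \<open>d i\<close> along the tree.\<close>
  show ?thesis
  proof (cases "f i v = r")
    case True
    then have "parent i e = root_edge i" using par by (simp add: edge_at_def root_edge_def)
    then have "edge_rank i (parent i e) = 0"
      using parent_tree[OF i e(1)] by (simp add: edge_rank_def)
    then show ?thesis using rk by simp
  next
    case False
    then have "parent i e = up_edge i (f i v)" using par by (simp add: edge_at_def)
    then have "edge_rank i (parent i e) \<le> Suc (d i (f i v))"
      using rank_tree_le[OF i, of "f i v"] f[OF i v(1)] False by simp
    then show ?thesis using rk f[OF i v(1)] by simp
  qed
next
  case False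
  obtain v where v: "v \<in> V - {r}" "parent i e = up_edge i v"
    using parent_tree[OF i e(1)] by (auto simp: tree_edges_def)
  have "d i v \<le> (\<Sum>v\<in>V. d i v)" using v(1) finV by (intro member_le_sum) auto
  then show ?thesis using rank_tree_le[OF i v(1)] v(2) False by (simp add: edge_rank_def)
qed

text \<open>Since \<open>j < i\<close>, the edge \<open>v = up_edge j x\<close> attaches to tree
  \<open>i\<close> at its lower end \<open>x\<close>, while \<open>w = up_edge i x\<close> attaches
  to tree \<open>j\<close> at its upper end \<open>f i x\<close>. If that end is not
  \<open>r\<close>, injectivity gives \<open>x = f i x\<close>; if it is \<open>r\<close>, both
  trees contain the edge from \<open>x\<close> to \<open>r\<close>.\<close>

lemma no_mutual_parents:
  assumes ij: "i < k" "j < i" and v: "v \<in> E" and w: "w \<in> E"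
    and par: "parent i v = w" "parent j w = v"
  shows False
proof -
  have j: "j < k" using ij by simp
  obtain x where x: "x \<in> V - {r}" "v = up_edge j x"
    using parent_tree[OF j w] par(2) by (auto simp: tree_edges_def)
  have wx: "w = up_edge i x"
    using par(1) link_up_edge[OF j x(1), of i] ij x by (simp add: parent_def edge_at_def)
  have vx: "v = edge_at j (f i x)"
    using par(2) link_up_edge[OF ij(1) x(1), of j] ij wx by (simp add: parent_def)
  show False
  proof (cases "f i x = r")
    case True
    have "up_edge j x = up_edge j (root_child j)" using vx x(2) True by (simp add: edge_at_def)
    then have "x = root_child j"
      using inj_onD[OF up_edge_inj[OF j]] x(1) root_child[OF j] by blast
    then have "f j x = r" using root_child[OF j] by simp
    then show False using disj[OF j ij(1) _ x(1) x(1)] ij(2) True by simp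
  next
    case False
    then have "up_edge j x = up_edge j (f i x)" using vx x(2) by (simp add: edge_at_def)
    then have "x = f i x"
      using inj_onD[OF up_edge_inj[OF j]] x(1) f[OF ij(1) x(1)] False by blast
    then show False using f[OF ij(1) x(1)] by simp
  qed
qed

lemma line_graph_has_cists: "has_cists (line_graph \<lparr>vertices = V, edges = E\<rparr>) k"
proof -
  let ?L = "line_graph \<lparr>vertices = V, edges = E\<rparr>"
  have L: "vertices ?L = E" by (simp add: line_graph_def)
  show ?thesis
  proof (rule has_cists_by_parents[where r = root_edge and f = parent and rank = edge_rank and cl = part])
    show "finite (vertices ?L)"
      unfolding L using E finV by (intro finite_subset[of E "Pow V"]) auto
    show "root_edge i \<in> vertices ?L" if "i < k" for i
      unfolding L root_edge_def using tree_edges_E[OF that] up_edge_tree root_child[OF that] by blast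
  next
    fix i e assume i: "i < k" and "e \<in> vertices ?L" and ne: "e \<noteq> root_edge i"
    then have e: "e \<in> E" by (simp add: L)
    note t = parent_tree[OF i e]
    have pE: "parent i e \<in> E" using t tree_edges_E[OF i] by blast
    note rk = edge_rank_parent[OF i e ne]
    have "link i e \<in> e \<inter> parent i e"
      using link_in[OF e] edge_at_in[OF i] by (simp add: parent_def)
    then have "e \<inter> parent i e \<noteq> {}" by blast
    moreover have "e \<noteq> parent i e" using rk by auto
    ultimately have "{e, parent i e} \<in> edges ?L"
      using e pE by (auto simp: line_graph_def)
    then show "parent i e \<in> vertices ?L \<and> {e, parent i e} \<in> edges ?L \<and>
        edge_rank i (parent i e) < edge_rank i e \<and> part (parent i e) = i"
      using pE rk part_eq[OF i t] by (simp add: L)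
  next
    fix i j v w assume "i < k" "j < k" "i \<noteq> j" "v \<in> vertices ?L" "w \<in> vertices ?L"
      "parent i v = w" "parent j w = v"
    then show False
      using no_mutual_parents[of i j v w] no_mutual_parents[of j i w v] by (cases "j < i") (auto simp: L)
  qed
qed

end

section \<open>Edge cuts and the connectivity of the line graph\<close>

definition edge_boundary :: "'a set set \<Rightarrow> 'a set \<Rightarrow> 'a set set" where
  "edge_boundary E X = {e \<in> E. e \<inter> X \<noteq> {} \<and> \<not> e \<subseteq> X}"

text \<open>Choosing a point of \<open>e\<close> in each class it meets is injective because the
  classes are disjoint.\<close>

lemma card_partition_meets_le:
  assumes "partition_on V P" "finite e"
  shows "card {X \<in> P. e \<inter> X \<noteq> {}} \<le> card e"
proof -
  define g where "g X = (SOME x. x \<in> e \<inter> X)" for X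
  have g: "g X \<in> e \<inter> X" if "X \<in> P" "e \<inter> X \<noteq> {}" for X
    unfolding g_def using that(2) by (subst some_in_eq)
  show ?thesis
  proof (rule card_inj_on_le[of g])
    show "inj_on g {X \<in> P. e \<inter> X \<noteq> {}}"
    proof (rule inj_onI)
      fix X Y assume X: "X \<in> {X \<in> P. e \<inter> X \<noteq> {}}" and Y: "Y \<in> {X \<in> P. e \<inter> X \<noteq> {}}"
        and eq: "g X = g Y"
      have "g X \<in> X" "g X \<in> Y" using g[of X] g[of Y] X Y eq by auto
      moreover have "disjnt X Y" if "X \<noteq> Y"
        using partition_onD2[OF assms(1)] X Y that by (auto simp: pairwise_def)
      ultimately show "X = Y" by (auto simp: disjnt_iff)
    qed
    show "g ` {X \<in> P. e \<inter> X \<noteq> {}} \<subseteq> e" using g by auto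
  qed fact
qed

text \<open>Double counting of pairs of a class and a crossing edge meeting it: each class
  contributes at least \<open>m\<close> edges, and each edge meets at most two classes.\<close>

lemma partition_crossing_edges:
  assumes V: "finite V" and E: "finite E" "\<And>e. e \<in> E \<Longrightarrow> card e = 2"
    and cuts: "\<And>X. X \<subseteq> V \<Longrightarrow> X \<noteq> {} \<Longrightarrow> X \<noteq> V \<Longrightarrow> m \<le> card (edge_boundary E X)"
    and P: "partition_on V P" "2 \<le> card P"
  shows "m * card P \<le> 2 * card {e \<in> E. \<not> (\<exists>X\<in>P. e \<subseteq> X)}"
proof -
  define C where "C = {e \<in> E. \<not> (\<exists>X\<in>P. e \<subseteq> X)}"
  have finC: "finite C" using E(1) by (simp add: C_def)
  have finP: "finite P" using P(2) by (intro card_ge_0_finite) simp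
  have dis: "X \<inter> Y = {}" if "X \<in> P" "Y \<in> P" "X \<noteq> Y" for X Y
    using partition_onD2[OF P(1)] that by (auto simp: pairwise_def disjnt_def)
  have ne: "X \<noteq> {}" if "X \<in> P" for X using partition_onD3[OF P(1)] that by auto
  have sub: "X \<subseteq> V" if "X \<in> P" for X using partition_onD1[OF P(1)] that by auto
  have "m \<le> card {e \<in> C. e \<inter> X \<noteq> {}}" if X: "X \<in> P" for X
  proof -
    have "\<exists>Y\<in>P. Y \<noteq> X"
    proof (rule ccontr)
      assume "\<not> (\<exists>Y\<in>P. Y \<noteq> X)"
      then have "P \<subseteq> {X}" by blast
      from card_mono[OF _ this] show False using P(2) by simp
    qed
    then obtain Y where Y: "Y \<in> P" "Y \<noteq> X" by blast
    have "X \<noteq> V" using dis[OF Y(1) X Y(2)] ne[OF Y(1)] sub[OF Y(1)] by blast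
    then have "m \<le> card (edge_boundary E X)" using cuts[OF sub[OF X] ne[OF X]] by simp
    also have "\<dots> \<le> card {e \<in> C. e \<inter> X \<noteq> {}}"
    proof (rule card_mono)
      show "edge_boundary E X \<subseteq> {e \<in> C. e \<inter> X \<noteq> {}}"
      proof
        fix e assume "e \<in> edge_boundary E X"
        then have e: "e \<in> E" "e \<inter> X \<noteq> {}" "\<not> e \<subseteq> X" by (auto simp: edge_boundary_def)
        have "\<not> e \<subseteq> Z" if "Z \<in> P" for Z using dis[OF that X] e by blast
        then show "e \<in> {e \<in> C. e \<inter> X \<noteq> {}}" using e unfolding C_def by blast
      qed
    qed (use finC in simp)
    finally show ?thesis .
  qed
  then have "m * card P \<le> (\<Sum>X\<in>P. card {e \<in> C. e \<inter> X \<noteq> {}})"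
    using sum_mono[of P "\<lambda>_. m" "\<lambda>X. card {e \<in> C. e \<inter> X \<noteq> {}}"] by (simp add: mult.commute)
  also have "\<dots> = (\<Sum>e\<in>C. card {X \<in> P. e \<inter> X \<noteq> {}})"
    unfolding card_eq_sum by (rule sum.swap_restrict[OF finP finC])
  also have "\<dots> \<le> (\<Sum>e\<in>C. 2)"
  proof (rule sum_mono)
    fix e assume "e \<in> C"
    then have "card e = 2" using E(2) by (simp add: C_def)
    then show "card {X \<in> P. e \<inter> X \<noteq> {}} \<le> 2"
      using card_partition_meets_le[OF P(1), of e] card_ge_0_finite[of e] by simp
  qed
  finally show ?thesis by (simp add: C_def)
qed

section \<open>Cuts of the graph and vertex cuts of its line graph\<close>

lemma delete_vertices_line_graph:
  "delete_vertices (line_graph G) S = line_graph \<lparr>vertices = vertices G, edges = edges G - S\<rparr>"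
  unfolding delete_vertices_def line_graph_def by auto

lemma simple_graph_finite_edges:
  assumes "simple_graph G"
  shows "finite (edges G)"
  using assms unfolding simple_graph_def by (intro finite_subset[of "edges G" "Pow (vertices G)"]) auto

text \<open>Once the boundary is deleted, every remaining edge that meets \<open>X\<close> lies
  inside \<open>X\<close>, so a walk in the line graph starting at \<open>e\<close> never reaches
  \<open>f\<close>.\<close>

lemma vertex_connectivity_line_graph_le:
  assumes G: "simple_graph G" and e: "e \<in> edges G" "e \<subseteq> X" and f: "f \<in> edges G" "f \<inter> X = {}"
  shows "vertex_connectivity (line_graph G) \<le> card (edge_boundary (edges G) X)"
proof -
  let ?B = "edge_boundary (edges G) X"
  let ?L = "line_graph \<lparr>vertices = vertices G, edges = edges G - ?B\<rparr>"
  have ne: "e \<noteq> {}" "f \<noteq> {}" using G e f unfolding simple_graph_def by fastforce+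
  have "\<not> connected_graph ?L"
  proof
    assume con: "connected_graph ?L"
    have "e \<in> vertices ?L" "f \<in> vertices ?L"
      using e f by (auto simp: line_graph_def edge_boundary_def)
    then obtain p where p: "is_path ?L e p f" using con unfolding connected_graph_def by blast
    have "(e, f) \<in> conn (edges ?L)" using path_conn[of p "edges ?L"] p unfolding is_path_def by auto
    then have "f \<subseteq> X"
    proof (induction rule: conn_induct)
      case base
      show ?case by (rule e(2))
    next
      case (step y z)
      obtain a b where ab: "{y, z} = {a, b}" "a \<in> edges G - ?B" "b \<in> edges G - ?B" "a \<inter> b \<noteq> {}"
        using step.hyps(2) unfolding line_graph_def by auto
      have "z \<in> edges G" "z \<notin> ?B" "y \<inter> z \<noteq> {}"
        using ab by (auto simp: doubleton_eq_iff)
      then show ?case using step.IH unfolding edge_boundary_def by blast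
    qed
    then show False using f ne by blast
  qed
  then have "\<not> connected_graph (delete_vertices (line_graph G) ?B)"
    by (simp add: delete_vertices_line_graph)
  moreover have "?B \<subseteq> vertices (line_graph G)" by (auto simp: line_graph_def edge_boundary_def)
  ultimately show ?thesis unfolding vertex_connectivity_def by (intro Least_le) blast
qed

lemma min_degree_le:
  assumes "simple_graph G" "v \<in> vertices G" "{e \<in> edges G. v \<in> e} \<subseteq> F" "finite F"
  shows "min_degree G \<le> card F"
proof -
  have "min_degree G \<le> degree G v"
    unfolding min_degree_def using assms by (intro Min_le) (auto simp: simple_graph_def)
  also have "\<dots> \<le> card F" unfolding degree_def using assms by (intro card_mono)
  finally show ?thesis .
qed

lemma edge_boundary_lower_bound:
  assumes G: "simple_graph G" and X: "X \<subseteq> vertices G" "X \<noteq> {}" "X \<noteq> vertices G"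
  shows "min (min_degree G) (vertex_connectivity (line_graph G)) \<le> card (edge_boundary (edges G) X)"
proof -
  have fin: "finite (edge_boundary (edges G) X)"
    using simple_graph_finite_edges[OF G] by (simp add: edge_boundary_def)
  \<comment> \<open>If no edge lies inside \<open>X\<close>, all edges at any vertex of
    \<open>X\<close> belong to the boundary, which therefore has at least minimum-degree many edges;
    \<open>outside\<close> is the same for the complement.\<close>
  consider (split) e f where "e \<in> edges G" "e \<subseteq> X" "f \<in> edges G" "f \<inter> X = {}"
    | (inside) "\<And>e. e \<in> edges G \<Longrightarrow> \<not> e \<subseteq> X" | (outside) "\<And>e. e \<in> edges G \<Longrightarrow> e \<inter> X \<noteq> {}"
    by blast
  then show ?thesis
  proof cases
    case split
    then show ?thesis using vertex_connectivity_line_graph_le[OF G] by (simp add: min.coboundedI2)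
  next
    case inside
    obtain v where v: "v \<in> X" using X by auto
    then have "{e \<in> edges G. v \<in> e} \<subseteq> edge_boundary (edges G) X"
      using inside by (auto simp: edge_boundary_def)
    then show ?thesis using min_degree_le[OF G _ _ fin, of v] v X by (auto simp: min.coboundedI1)
  next
    case outside
    obtain v where v: "v \<in> vertices G" "v \<notin> X" using X by auto
    then have "{e \<in> edges G. v \<in> e} \<subseteq> edge_boundary (edges G) X"
      using outside by (auto simp: edge_boundary_def)
    then show ?thesis using min_degree_le[OF G v(1) _ fin] by (auto simp: min.coboundedI1)
  qed
qed

section \<open>From cut bounds to independent trees\<close>

lemma half_packing_bound:
  fixes m t c s :: nat
  assumes "m * t \<le> 2 * c" "s \<le> (m + 1) div 2" "2 \<le> t"
  shows "(m div 2) * (t - 1) \<le> c - s"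
proof -
  define k where "k = m div 2"
  obtain t' where t: "t = t' + 2" using assms(3) by (metis add.commute le_iff_add)
  \<comment> \<open>For even \<open>m\<close>, \<open>c\<close> is at least \<open>k * t\<close> and
    \<open>s\<close> at most \<open>k\<close>. For odd \<open>m\<close>, \<open>s\<close> may be
    \<open>k + 1\<close>, and the extra edge is paid for by the additional \<open>t / 2\<close> in
    the bound on \<open>c\<close>, which is at least 1 as \<open>t\<close> is at least 2.\<close>
  consider "m = 2 * k" | "m = 2 * k + 1" unfolding k_def by linarith
  then show ?thesis
  proof cases
    case 1
    then have "k * t' + 2 * k \<le> c" "s \<le> k" using assms(1,2) t by (auto simp: algebra_simps)
    then show ?thesis unfolding k_def[symmetric] t by simp
  next
    case 2
    then have "2 * (k * t') + 4 * k + t' + 2 \<le> 2 * c" "s \<le> k + 1"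
      using assms(1,2) t by (auto simp: algebra_simps)
    then have "k * t' + 2 * k + 1 \<le> c" "s \<le> k + 1" by linarith+
    then show ?thesis unfolding k_def[symmetric] t by simp
  qed
qed

lemma line_graph_cists:
  assumes G: "simple_graph G" and S: "S \<subset> edges G"
    and m: "\<And>X. X \<subseteq> vertices G \<Longrightarrow> X \<noteq> {} \<Longrightarrow> X \<noteq> vertices G \<Longrightarrow> m \<le> card (edge_boundary (edges G) X)"
    and card_S: "card S \<le> (m + 1) div 2"
  shows "has_cists (delete_vertices (line_graph G) S) (m div 2)"
proof -
  define V where "V = vertices G"
  define E where "E = edges G - S"
  define k where "k = m div 2"
  have finV: "finite V" and E2: "\<And>e. e \<in> edges G \<Longrightarrow> e \<subseteq> V \<and> card e = 2"
    using G by (auto simp: simple_graph_def V_def)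
  have finE: "finite (edges G)" by (rule simple_graph_finite_edges[OF G])
  \<comment> \<open>Properness of \<open>S\<close> provides an edge, hence a root and a second
    vertex.\<close>
  obtain e where "e \<in> edges G" using S by blast
  then obtain r s where rs: "r \<in> V" "s \<in> V" "r \<noteq> s" using E2[of e] by (auto simp: card_2_iff)
  have E2': "e \<subseteq> V \<and> card e = 2" if "e \<in> E" for e using E2 that by (simp add: E_def)
  have cuts: "k * (card P - 1) \<le> card {e \<in> E. \<not> (\<exists>X\<in>P. e \<subseteq> X)}" if P: "partition_on V P" for P
  \<comment> \<open>With fewer than two classes the left side is 0, so only genuine partitions need
    the cut bound.\<close>
  proof (cases "2 \<le> card P")
    case True
    let ?C = "{e \<in> edges G. \<not> (\<exists>X\<in>P. e \<subseteq> X)}"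
    have "m * card P \<le> 2 * card ?C"
      using partition_crossing_edges[OF finV finE _ _ P True, of m] E2 m unfolding V_def by blast
    then have "k * (card P - 1) \<le> card ?C - card S"
      unfolding k_def using half_packing_bound card_S True by blast
    also have "\<dots> \<le> card (?C - S)" using S finE by (intro diff_card_le_card_Diff) (auto intro: finite_subset)
    also have "?C - S = {e \<in> E. \<not> (\<exists>X\<in>P. e \<subseteq> X)}" by (auto simp: E_def)
    finally show ?thesis .
  qed simp
  obtain T where T: "\<And>i. i < k \<Longrightarrow> T i \<subseteq> E"
    "\<And>i j. i < k \<Longrightarrow> j < k \<Longrightarrow> i \<noteq> j \<Longrightarrow> T i \<inter> T j = {}"
    "\<And>i u v. i < k \<Longrightarrow> u \<in> V \<Longrightarrow> v \<in> V \<Longrightarrow> (u, v) \<in> conn (T i)"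
    using tree_packing[OF finV _ E2' cuts] rs(1) by (metis empty_iff)
  have "\<exists>f d. \<forall>v\<in>V - {r}. f v \<in> V \<and> {v, f v} \<in> T i \<and> d (f v) < (d v :: nat)" if i: "i < k" for i
  proof (rule connected_rooted_tree)
    show "e \<subseteq> V" if "e \<in> T i" for e using T(1)[OF i] E2' that by blast
    show "(v, r) \<in> conn (T i)" if "v \<in> V" for v using T(3)[OF i that rs(1)] .
  qed
  then obtain f d where fd: "\<And>i v. i < k \<Longrightarrow> v \<in> V - {r} \<Longrightarrow>
      f i v \<in> V \<and> {v, f i v} \<in> T i \<and> d i (f i v) < (d i v :: nat)"
    by metis
  interpret rooted_trees V E k r f d
  proof
    show "V - {r} \<noteq> {}" using rs by auto
    show "f i v \<in> V \<and> {v, f i v} \<in> E \<and> d i (f i v) < d i v" if "i < k" "v \<in> V - {r}" for i v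
      using fd[OF that] T(1)[OF that(1)] by blast
    show "{v, f i v} \<noteq> {w, f j w}" if "i < k" "j < k" "i \<noteq> j" "v \<in> V - {r}" "w \<in> V - {r}" for i j v w
      using fd[OF that(1,4)] fd[OF that(2,5)] T(2)[OF that(1-3)] by (metis disjoint_iff)
  qed (use finV rs E2' in auto)
  show ?thesis
    using line_graph_has_cists unfolding delete_vertices_line_graph V_def E_def k_def .
qed

lemma connectivity_line_graph_le_min_degree:
  assumes G: "simple_graph G" "connected_graph G" and not_super: "\<not> super_edge_connected G"
  shows "vertex_connectivity (line_graph G) \<le> min_degree G"
proof -
  obtain F where F: "is_min_edge_cut G F"
    and iso: "\<And>v. v \<in> vertices G \<Longrightarrow> degree (delete_edges G F) v \<noteq> 0"
    using not_super G(2) unfolding super_edge_connected_def by auto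
  have finE: "finite (edges G)" by (rule simple_graph_finite_edges[OF G(1)])
  have V: "finite (vertices G)" "vertices G \<noteq> {}"
    and E: "\<And>e. e \<in> edges G \<Longrightarrow> e \<subseteq> vertices G \<and> card e = 2"
    using G by (auto simp: simple_graph_def connected_graph_def)
  have cut: "F \<subseteq> edges G" "\<not> connected_graph (delete_edges G F)"
    and minimal: "\<And>F'. is_edge_cut G F' \<Longrightarrow> card F \<le> card F'"
    using F by (auto simp: is_min_edge_cut_def is_edge_cut_def)
  let ?H = "delete_edges G F"
  have H: "vertices ?H = vertices G" "edges ?H = edges G - F" by (simp_all add: delete_edges_def)
  obtain u v where uv: "u \<in> vertices G" "v \<in> vertices G" "\<nexists>p. is_path ?H u p v"
    using cut(2) V(2) unfolding connected_graph_def H by blast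
  have not_conn: "(u, v) \<notin> conn (edges G - F)"
    using conn_path[of u v ?H] uv E unfolding H by blast
  \<comment> \<open>The side of \<open>u\<close> after removal of \<open>F\<close>. It is closed
    under the remaining edges, so its boundary lies in \<open>F\<close>; as \<open>u\<close> and
    \<open>v\<close> are not isolated, an edge survives on each side.\<close>
  define X where "X = {x \<in> vertices G. (u, x) \<in> conn (edges G - F)}"
  have closed: "y \<in> X" if "e \<in> edges G - F" "x \<in> e" "y \<in> e" "x \<in> X" for e x y
  proof -
    have "card e = 2" using E that(1) by blast
    then obtain a b where ab: "e = {a, b}" by (auto simp: card_2_iff)
    have "(x, y) \<in> conn (edges G - F)"
    proof (cases "x = y")
      case False
      then have "{x, y} = e" using that(2,3) ab by auto
      then show ?thesis using that(1) by (intro conn_edge) simp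
    qed simp
    then have "(u, y) \<in> conn (edges G - F)" using that(4) conn_trans unfolding X_def by fast
    then show ?thesis using E[of e] that unfolding X_def by auto
  qed
  have nonisolated: "\<exists>e\<in>edges G - F. w \<in> e" if w: "w \<in> vertices G" for w
  proof (rule ccontr)
    assume "\<not> (\<exists>e\<in>edges G - F. w \<in> e)"
    then have "{e \<in> edges ?H. w \<in> e} = {}" unfolding H by blast
    then show False using iso[OF w] by (simp only: degree_def card.empty)
  qed
  obtain e where e: "e \<in> edges G - F" "u \<in> e" using nonisolated[OF uv(1)] by blast
  obtain f where f: "f \<in> edges G - F" "v \<in> f" using nonisolated[OF uv(2)] by blast
  have uX: "u \<in> X" using uv(1) by (simp add: X_def)
  have vX: "v \<notin> X" using not_conn by (simp add: X_def)
  have "vertex_connectivity (line_graph G) \<le> card (edge_boundary (edges G) X)"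
  proof (rule vertex_connectivity_line_graph_le[OF G(1)])
    show "e \<in> edges G" "f \<in> edges G" using e f by auto
    show "e \<subseteq> X" using closed[OF e(1,2) _ uX] by blast
    show "f \<inter> X = {}" using closed[OF f(1) _ f(2)] vX by blast
  qed
  also have "\<dots> \<le> card F"
  proof (rule card_mono)
    show "finite F" using cut(1) finE by (rule finite_subset)
    show "edge_boundary (edges G) X \<subseteq> F"
      using closed unfolding edge_boundary_def by blast
  qed
  also have "card F \<le> min_degree G"
  proof -
    have "min_degree G \<in> degree G ` vertices G" unfolding min_degree_def using V by (intro Min_in) auto
    then obtain w where w: "w \<in> vertices G" "min_degree G = degree G w" by (rule imageE)
    \<comment> \<open>The edges at a vertex of minimum degree cut it off from any other vertex, so a
      minimum edge-cut has at most minimum-degree many edges.\<close>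
    define D where "D = {e \<in> edges G. w \<in> e}"
    have "u \<noteq> v" using not_conn by auto
    then obtain x where x: "x \<in> vertices G" "x \<noteq> w" using uv(1,2) by metis
    have "\<not> connected_graph (delete_edges G D)"
    proof
      assume "connected_graph (delete_edges G D)"
      then obtain p where p: "is_path (delete_edges G D) w p x"
        using w(1) x(1) unfolding connected_graph_def delete_edges_def by auto
      have "(w, x) \<in> conn (edges G - D)"
        using path_conn[of p "edges G - D"] p unfolding is_path_def delete_edges_def by auto
      then have "x = w"
      proof (induction rule: conn_induct)
        case (step y z)
        then show ?case by (simp add: D_def)
      qed simp
      then show False using x(2) by simp
    qed
    then have "is_edge_cut G D" unfolding is_edge_cut_def D_def by auto
    then show ?thesis using minimal w(2) by (simp add: degree_def D_def)
  qed
  finally show ?thesis .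
qed

theorem theorem10:
  fixes G :: "'a ugraph"
  assumes "simple_graph G" and "connected_graph G"
  shows "(\<forall>S. S \<subset> vertices (line_graph G) \<and>
              int (card S) \<le> \<lceil>real (min (min_degree G) (vertex_connectivity (line_graph G))) / 2\<rceil> \<longrightarrow>
            has_cists (delete_vertices (line_graph G) S)
              (nat \<lfloor>real (min (min_degree G) (vertex_connectivity (line_graph G))) / 2\<rfloor>)) \<and>
         (\<not> super_edge_connected G \<longrightarrow>
            (\<forall>S. S \<subset> vertices (line_graph G) \<and>
                 int (card S) \<le> \<lceil>real (vertex_connectivity (line_graph G)) / 2\<rceil> \<longrightarrow>
               has_cists (delete_vertices (line_graph G) S)
                 (nat \<lfloor>real (vertex_connectivity (line_graph G)) / 2\<rfloor>)))"
proof -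
  let ?\<kappa> = "vertex_connectivity (line_graph G)"
  let ?m = "min (min_degree G) ?\<kappa>"
  have main: "has_cists (delete_vertices (line_graph G) S) (nat \<lfloor>real ?m / 2\<rfloor>)"
    if S: "S \<subset> vertices (line_graph G)" "int (card S) \<le> \<lceil>real ?m / 2\<rceil>" for S
  proof -
    have "\<lceil>real ?m / 2\<rceil> \<le> int ((?m + 1) div 2)" by (rule ceiling_le) linarith
    then have "card S \<le> (?m + 1) div 2" using S(2) by linarith
    moreover have "S \<subset> edges G" using S(1) by (simp add: line_graph_def)
    ultimately have "has_cists (delete_vertices (line_graph G) S) (?m div 2)"
      using edge_boundary_lower_bound[OF assms(1)] by (intro line_graph_cists[OF assms(1)])
    moreover have "nat \<lfloor>real ?m / 2\<rfloor> = ?m div 2"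
      using floor_divide_of_nat_eq[of ?m 2, where 'a = real] by simp
    ultimately show ?thesis by simp
  qed
  \<comment> \<open>The minimum collapses to the connectivity of the line graph, so the second claim
    is an instance of the first.\<close>
  moreover have "?m = ?\<kappa>" if "\<not> super_edge_connected G"
    using connectivity_line_graph_le_min_degree[OF assms that] by simp
  ultimately show ?thesis by metis
qed

end
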